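(* In the isotropic Gaussian mixture model with fixed mean shape described in the context, suppose in addition that $\pi_k=1/K$ for all $k$ and $m_k^{\top}m_\ell=K\,\mathbf 1\{k=\ell\}-1$ for all $k,\ell$. Then $D_0=I_r$ and $$L_{\mathrm{crit},n}=\frac{C_K\sigma_n^2\log n}{2}\left(1+\sqrt{1+\frac{4p}{C_Kn\log n}}\right),\qquad C_K=\begin{cases}2,&K=2,\\ 4\{K-1+\sqrt{K(K-2)}\},&K\ge3.\end{cases}$$ Equivalently, $L_{\mathrm{crit},n}$ satisfies $$\frac{L_{\mathrm{crit},n}^{2}}{\sigma_n^2L_{\mathrm{crit},n}+\sigma_n^4p/n}=C_K\log n .$$ Here $L_{\mathrm{crit},n}=\sigma_n^2t_{\mathrm{crit},n}$, where $t_{\mathrm{crit},n}$ is the unique $t>0$ with $\mathfrak d(\Omega_n(t))=2\log n$.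
   Context: Fix an integer $K\ge2$, $r=K-1$, mixing proportions $\pi_1,\dots,\pi_K>0$ with $\sum_k\pi_k=1$, and vectors $m_1,\dots,m_K\in\mathbb R^r$ with $\sum_k\pi_km_k=0$, $D_0:=\sum_k\pi_km_km_k^{\top}\succ0$, $\lambda_{\min}(D_0)=1$. For each $n\ge K$ let $p=p_n\ge r$, $U_n\in\mathbb R^{p\times r}$ with orthonormal columns, $L_n,\sigma_n>0$, $\bar\mu\in\mathbb R^p$, and let $x_i=\bar\mu+\sqrt{L_n}\,U_nm_{Z_i}+\sigma_n\xi_i$, $i=1,\dots,n$, with iid labels $Z_i$, $\mathbb P(Z_i=k)=\pi_k$, and independent iid $\xi_i\sim N(0,I_p)$. Definitions: $q_k=D_0^{-1/2}m_k$, $\gamma_n=p/n$. For $t>0$, $\Omega_n(t)=\frac1tD_0^{-1}+\frac{\gamma_n}{t^2}D_0^{-2}$. $s_{k\ell}=1$ if $k=\ell$ and $s_{k\ell}=-1$ if $k\ne\ell$. For every positive definite $r\times r$ matrix $W$, $$\mathfrak d(W)=\min_{1\le k\le\ell\le K}\ \inf_{\substack{x,y\in\mathbb R^r:\\ s_{k\ell}(q_k+x)^{\top}(q_\ell+y)\le0}}\max\{x^{\top}W^{-1}x,\ y^{\top}W^{-1}y\}.$$ For every $n\ge K$ the equation $\mathfrak d(\Omega_n(t))=2\log n$ has a unique solution $t=t_{\mathrm{crit},n}>0$; $L_{\mathrm{crit},n}=\sigma_n^2t_{\mathrm{crit},n}$ is the critical signal strength for exact sign recovery by the PCA connectivity projection.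 *)

theory Defs
  imports "HOL-Probability.Probability"
begin

text \<open>
  The dimension r = K - 1 is carried by a finite index type \<open>'r\<close>; components are indexed by
  the natural numbers 1, ..., K.
\<close>

definition pos_def :: "real^'r^'r \<Rightarrow> bool" where
  "pos_def A \<longleftrightarrow> transpose A = A \<and> (\<forall>v. v \<noteq> 0 \<longrightarrow> 0 < v \<bullet> (A *v v))"

definition lambda_min :: "real^'r^'r \<Rightarrow> real" where
  "lambda_min A = Min {c. \<exists>v. v \<noteq> 0 \<and> A *v v = c *\<^sub>R v}"

text \<open>
  The principal square root. The description is proper for positive definite arguments only.
\<close>

definition mat_sqrt :: "real^'r^'r \<Rightarrow> real^'r^'r" where
  "mat_sqrt A = (THE S. pos_def S \<and> S ** S = A)"

definition outer_prod :: "real^'r \<Rightarrow> real^'r \<Rightarrow> real^'r^'r" where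
  "outer_prod u v = (\<chi> i j. u $ i * v $ j)"

definition D0 :: "nat \<Rightarrow> (nat \<Rightarrow> real) \<Rightarrow> (nat \<Rightarrow> real^'r) \<Rightarrow> real^'r^'r" where
  "D0 K \<pi> m = (\<Sum>k=1..K. \<pi> k *\<^sub>R outer_prod (m k) (m k))"

definition whitened :: "nat \<Rightarrow> (nat \<Rightarrow> real) \<Rightarrow> (nat \<Rightarrow> real^'r) \<Rightarrow> nat \<Rightarrow> real^'r" where
  "whitened K \<pi> m k = matrix_inv (mat_sqrt (D0 K \<pi> m)) *v m k"

definition Omega :: "real^'r^'r \<Rightarrow> real \<Rightarrow> real \<Rightarrow> real^'r^'r" where
  "Omega D \<gamma> t = (1 / t) *\<^sub>R matrix_inv D + (\<gamma> / t\<^sup>2) *\<^sub>R (matrix_inv D ** matrix_inv D)"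

definition pair_sign :: "nat \<Rightarrow> nat \<Rightarrow> real" where
  "pair_sign k l = (if k = l then 1 else - 1)"

text \<open>
  For positive definite \<open>W\<close> the infima below are over nonempty sets (take x = -q k, y = -q l) of
  nonnegative reals, so the real-valued infimum is the intended one.
\<close>

definition sign_margin :: "nat \<Rightarrow> (nat \<Rightarrow> real^'r) \<Rightarrow> real^'r^'r \<Rightarrow> real" where
  "sign_margin K q W =
     Min ((\<lambda>(k, l).
             INF (x, y) \<in> {(x, y). pair_sign k l * ((q k + x) \<bullet> (q l + y)) \<le> 0}.
               max (x \<bullet> (matrix_inv W *v x)) (y \<bullet> (matrix_inv W *v y)))
          ` {(k, l). 1 \<le> k \<and> k \<le> l \<and> l \<le> K})"

definition is_crit ::
  "nat \<Rightarrow> (nat \<Rightarrow> real) \<Rightarrow> (nat \<Rightarrow> real^'r) \<Rightarrow> nat \<Rightarrow> nat \<Rightarrow> real \<Rightarrow> bool" where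
  "is_crit K \<pi> m p n t \<longleftrightarrow>
     t > 0 \<and>
     sign_margin K (whitened K \<pi> m) (Omega (D0 K \<pi> m) (real p / real n) t) = 2 * ln (real n)"

definition t_crit ::
  "nat \<Rightarrow> (nat \<Rightarrow> real) \<Rightarrow> (nat \<Rightarrow> real^'r) \<Rightarrow> nat \<Rightarrow> nat \<Rightarrow> real" where
  "t_crit K \<pi> m p n = (THE t. is_crit K \<pi> m p n t)"

definition L_crit ::
  "nat \<Rightarrow> (nat \<Rightarrow> real) \<Rightarrow> (nat \<Rightarrow> real^'r) \<Rightarrow> nat \<Rightarrow> real \<Rightarrow> nat \<Rightarrow> real" where
  "L_crit K \<pi> m p \<sigma> n = \<sigma>\<^sup>2 * t_crit K \<pi> m p n"

definition C_const :: "nat \<Rightarrow> real" where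
  "C_const K =
     (if K = 2 then 2 else 4 * (real K - 1 + sqrt (real K * (real K - 2))))"

text \<open>
  The sample of size \<open>n\<close> in dimension \<open>p\<close>. A vector of the p-dimensional space is a function on
  \<open>{..<p}\<close>, and the p by r matrix is given by its rows \<open>U j\<close>, so that the j-th entry of the
  product of \<open>U\<close> with \<open>v\<close> is \<open>U j \<bullet> v\<close>. The product measure in \<open>noise_law\<close> is N(0, I).
\<close>

locale gaussian_mixture_sample = prob_space M
  for M :: "'w measure" +
  fixes K :: nat and \<pi> :: "nat \<Rightarrow> real" and m :: "nat \<Rightarrow> real^'r"
    and n p :: nat and U :: "nat \<Rightarrow> real^'r" and L \<sigma> :: real and \<mu> :: "nat \<Rightarrow> real"
    and Z :: "nat \<Rightarrow> 'w \<Rightarrow> nat" and \<xi> x :: "nat \<Rightarrow> 'w \<Rightarrow> nat \<Rightarrow> real"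
  assumes dim: "CARD('r) \<le> p"
    and orthonormal_columns:
      "\<And>a b. (\<Sum>j<p. U j $ a * U j $ b) = (if a = b then 1 else 0)"
    and L_pos: "L > 0" and sigma_pos: "\<sigma> > 0"
    and labels_indep: "indep_vars (\<lambda>_. count_space {1..K}) Z {1..n}"
    and labels_law:
      "\<And>i k. i \<in> {1..n} \<Longrightarrow> k \<in> {1..K} \<Longrightarrow> prob {\<omega> \<in> space M. Z i \<omega> = k} = \<pi> k"
    and noise_indep: "indep_vars (\<lambda>_. PiM {..<p} (\<lambda>_. borel)) \<xi> {1..n}"
    and noise_law:
      "\<And>i. i \<in> {1..n} \<Longrightarrow> distr M (PiM {..<p} (\<lambda>_. borel)) (\<xi> i)
               = PiM {..<p} (\<lambda>_. density lborel (\<lambda>s. ennreal (std_normal_density s)))"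
    and labels_noise_indep:
      "indep_set
         {(\<lambda>\<omega>. \<lambda>i\<in>{1..n}. Z i \<omega>) -` A \<inter> space M |A.
            A \<in> sets (PiM {1..n} (\<lambda>_. count_space {1..K}))}
         {(\<lambda>\<omega>. \<lambda>i\<in>{1..n}. \<xi> i \<omega>) -` A \<inter> space M |A.
            A \<in> sets (PiM {1..n} (\<lambda>_. PiM {..<p} (\<lambda>_. borel)))}"
    and observations:
      "\<And>i j \<omega>. i \<in> {1..n} \<Longrightarrow> j < p \<Longrightarrow> \<omega> \<in> space M \<Longrightarrow>
         x i \<omega> j = \<mu> j + sqrt L * (U j \<bullet> m (Z i \<omega>)) + \<sigma> * \<xi> i \<omega> j"

end

theory Submission
  imports Defs
begin

text \<open>
  Since \<open>D0\<close> is the identity, \<open>Omega\<close> is a scalar matrix \<open>w I\<close>, and the sign margin is \<open>c / w\<close>,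
  where \<open>c\<close> is the squared Euclidean distance by which some pair of simplex vertices must be
  moved to violate its sign condition. For \<open>K \<ge> 3\<close> the cheapest pair consists of two distinct
  vertices; projecting their sum and difference onto the cone \<open>norm d \<le> norm s\<close> gives
  \<open>c = 2 / C_K\<close>. The critical equation is then quadratic in \<open>t\<close> with one positive root.
\<close>

section \<open>The second-moment matrix of the simplex\<close>

lemma outer_prod_mult_vector: "outer_prod u v *v w = (v \<bullet> w) *\<^sub>R u"
  by (simp add: vec_eq_iff matrix_vector_mult_def outer_prod_def inner_vec_def
      sum_distrib_left mult.commute mult.left_commute)

lemma sum_matrix_mult_vector: "(\<Sum>k\<in>A. F k) *v w = (\<Sum>k\<in>A. F k *v w)"
  for F :: "nat \<Rightarrow> real^'n^'m"
  by (induction A rule: infinite_finite_induct) (simp_all add: matrix_vector_mult_add_rdistrib)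

lemma D0_mult_vector: "D0 K \<pi> m *v v = (\<Sum>k=1..K. (\<pi> k * (m k \<bullet> v)) *\<^sub>R m k)"
  by (simp add: D0_def sum_matrix_mult_vector outer_prod_mult_vector scaleR_matrix_vector_assoc[symmetric])

lemma pos_def_mult_eq_0: "pos_def A \<Longrightarrow> A *v v = 0 \<Longrightarrow> v = 0"
  by (metis inner_zero_right less_irrefl pos_def_def)

text \<open>The matrix \<open>D0\<close> fixes every \<open>m l\<close>, hence is idempotent, and it is injective.\<close>
lemma D0_simplex:
  fixes m :: "nat \<Rightarrow> real^'r"
  assumes "K > 0"
    and centered: "(\<Sum>k=1..K. \<pi> k *\<^sub>R m k) = 0"
    and pd: "pos_def (D0 K \<pi> m)"
    and balanced: "\<And>k. k \<in> {1..K} \<Longrightarrow> \<pi> k = 1 / real K"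
    and simplex: "\<And>k l. k \<in> {1..K} \<Longrightarrow> l \<in> {1..K} \<Longrightarrow>
      m k \<bullet> m l = real K * (if k = l then 1 else 0) - 1"
  shows "D0 K \<pi> m = mat 1"
proof -
  let ?D = "D0 K \<pi> m"
  have fixed: "?D *v m l = m l" if l: "l \<in> {1..K}" for l
  proof -
    \<comment> \<open>With equal weights, \<open>\<pi> k * (m k \<bullet> m l)\<close> is the
      indicator of \<open>k = l\<close> minus \<open>\<pi> k\<close>; the second part sums to zero
      by centering.\<close>
    have "?D *v m l = (\<Sum>k=1..K. (if k = l then m k else 0) - \<pi> k *\<^sub>R m k)"
      unfolding D0_mult_vector
      by (intro sum.cong refl) (use l \<open>K > 0\<close> in \<open>auto simp: simplex balanced algebra_simps\<close>)
    also have "\<dots> = m l"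
      using l by (simp add: sum_subtractf centered del: One_nat_def)
    finally show ?thesis .
  qed
  have "?D *v v = v" for v
  proof -
    have "?D *v (?D *v v) = (\<Sum>k=1..K. (\<pi> k * (m k \<bullet> v)) *\<^sub>R (?D *v m k))"
      unfolding D0_mult_vector[of K \<pi> m v]
      by (simp add: linear_sum[OF matrix_vector_mul_linear] matrix_vector_mult_scaleR)
    also have "\<dots> = ?D *v v"
      unfolding D0_mult_vector[of K \<pi> m v] by (intro sum.cong refl) (simp add: fixed)
    finally have "?D *v (?D *v v) = ?D *v v" .
    then have "?D *v (?D *v v - v) = 0"
      by (simp add: matrix_vector_mult_diff_distrib)
    then show ?thesis
      using pos_def_mult_eq_0[OF pd] by fastforce
  qed
  then show ?thesis
    by (simp add: matrix_eq)
qed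

section \<open>Square root and inverse of scalar matrices\<close>

lemma pos_def_mat_1: "pos_def (mat 1 :: real^'r^'r)"
  by (simp add: pos_def_def transpose_mat)

text \<open>Uniqueness: if \<open>S ** S\<close> is the identity, then \<open>S *v v - v\<close> is
  sent to its negative, which positive definiteness allows only for the zero vector.\<close>

lemma mat_sqrt_mat_1: "mat_sqrt (mat 1 :: real^'r^'r) = mat 1"
  unfolding mat_sqrt_def
proof (rule the_equality)
  show "pos_def (mat 1 :: real^'r^'r) \<and> mat 1 ** mat 1 = (mat 1 :: real^'r^'r)"
    by (simp add: pos_def_mat_1)
next
  fix S :: "real^'r^'r"
  assume S: "pos_def S \<and> S ** S = mat 1"
  have "S *v v = v" for v
  proof (rule ccontr)
    define y where "y = S *v v - v"
    assume "S *v v \<noteq> v"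
    then have "0 < y \<bullet> (S *v y)"
      using S by (simp add: y_def pos_def_def)
    moreover have "S *v y = - y"
      using S by (simp add: y_def matrix_vector_mult_diff_distrib matrix_vector_mul_assoc)
    ultimately show False
      using inner_ge_zero[of y] by simp
  qed
  then show "S = mat 1"
    by (simp add: matrix_eq)
qed

lemma matrix_inv_unique:
  fixes A B :: "real^'r^'r"
  assumes "A ** B = mat 1"
  shows "matrix_inv A = B"
  unfolding matrix_inv_def
proof (rule some_equality)
  show "A ** B = mat 1 \<and> B ** A = mat 1"
    using assms matrix_left_right_inverse by blast
next
  fix C
  assume "A ** C = mat 1 \<and> C ** A = mat 1"
  then show "C = B"
    using assms by (metis matrix_mul_assoc matrix_mul_lid matrix_mul_rid)
qed

lemma matrix_inv_scaleR_mat_1: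
  assumes "w \<noteq> 0"
  shows "matrix_inv (w *\<^sub>R mat 1 :: real^'r^'r) = (1 / w) *\<^sub>R mat 1"
  by (rule matrix_inv_unique)
    (use assms in \<open>simp add: matrix_scalar_ac scalar_matrix_assoc[symmetric]\<close>)

lemma matrix_inv_mat_1: "matrix_inv (mat 1 :: real^'r^'r) = mat 1"
  using matrix_inv_scaleR_mat_1[of 1] by simp

section \<open>Moving a pair of vectors to a non-obtuse pair\<close>

text \<open>With \<open>s = u + v\<close> and \<open>d = u - v\<close> the constraint reads \<open>norm d \<le> norm s\<close>, and the sum of the
  two squared distances is half of the squared distance from \<open>(s, d)\<close> to \<open>(a + b, a - b)\<close>.\<close>
lemma acute_pair_distance:
  fixes a b u v :: "'a::real_inner"
  assumes "a \<bullet> b \<le> 0" "u \<bullet> v \<ge> 0"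
  shows "(norm (a - b) - norm (a + b))\<^sup>2 / 8 \<le> max ((norm (u - a))\<^sup>2) ((norm (v - b))\<^sup>2)"
proof -
  define S D s d where defs: "S = a + b" "D = a - b" "s = u + v" "d = u - v"
  have "norm S \<le> norm D"
    unfolding norm_le using assms(1) by (simp add: defs inner_simps inner_commute)
  have "norm d \<le> norm s"
    unfolding norm_le using assms(2) by (simp add: defs inner_simps inner_commute)
  have sum_eq: "(norm (u - a))\<^sup>2 + (norm (v - b))\<^sup>2 = ((norm (s - S))\<^sup>2 + (norm (d - D))\<^sup>2) / 2"
    by (simp add: defs power2_norm_eq_inner inner_simps inner_commute algebra_simps)
  have "0 \<le> norm D - norm S" "norm D - norm S \<le> norm (s - S) + norm (d - D)"
    using \<open>norm S \<le> norm D\<close> \<open>norm d \<le> norm s\<close>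
      norm_triangle_ineq2[of s S] norm_triangle_ineq2[of D d]
    by (simp_all add: norm_minus_commute)
  \<comment> \<open>The constant 8: the square of a sum is at most twice the sum of squares,
    \<open>sum_eq\<close> contributes another factor 2, and bounding the maximum below by the mean
    gives the last one.\<close>
  then have "(norm D - norm S)\<^sup>2 \<le> (norm (s - S) + norm (d - D))\<^sup>2"
    by (intro power_mono)
  also have "\<dots> \<le> 2 * ((norm (s - S))\<^sup>2 + (norm (d - D))\<^sup>2)"
    using zero_le_power2[of "norm (s - S) - norm (d - D)"]
    by (simp add: power2_eq_square algebra_simps)
  finally show ?thesis
    using sum_eq unfolding defs by linarith
qed

text \<open>Equal lengths make \<open>a + b\<close> and \<open>a - b\<close> orthogonal. Keeping
  their directions and replacing both lengths by the average makes the new sum and difference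
  equally long, so the new pair is orthogonal; by symmetry both vectors move equally far, so maximum
  and mean agree.\<close>

lemma acute_pair_distance_attained:
  fixes a b :: "'a::real_inner"
  assumes "a \<bullet> a = b \<bullet> b" "a + b \<noteq> 0" "a \<noteq> b"
  obtains u v where "u \<bullet> v = 0"
    "(norm (u - a))\<^sup>2 = (norm (a - b) - norm (a + b))\<^sup>2 / 8"
    "(norm (v - b))\<^sup>2 = (norm (a - b) - norm (a + b))\<^sup>2 / 8"
proof -
  define S D where SD: "S = a + b" "D = a - b"
  define e f where ef: "e = S /\<^sub>R norm S" "f = D /\<^sub>R norm D"
  \<comment> \<open>\<open>h\<close> is the mean of the half-lengths \<open>norm S / 2\<close> and
    \<open>norm D / 2\<close>, and \<open>g\<close> is their deviation from it.\<close>
  define h where "h = (norm S + norm D) / 4"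
  define g where "g = (norm D - norm S) / 4"
  have orth: "S \<bullet> D = 0"
    using assms(1) by (simp add: SD inner_simps inner_commute)
  have "S \<noteq> 0" "D \<noteq> 0"
    using assms by (simp_all add: SD)
  then have unit: "e \<bullet> e = 1" "f \<bullet> f = 1" "e \<bullet> f = 0"
    using orth by (simp_all add: ef dot_square_norm power2_eq_square)
  have ef': "(norm S / 2) *\<^sub>R e = (1 / 2) *\<^sub>R S" "(norm D / 2) *\<^sub>R f = (1 / 2) *\<^sub>R D"
    using \<open>S \<noteq> 0\<close> \<open>D \<noteq> 0\<close> by (simp_all add: ef)
  have ab: "a = (norm S / 2) *\<^sub>R e + (norm D / 2) *\<^sub>R f"
      "b = (norm S / 2) *\<^sub>R e - (norm D / 2) *\<^sub>R f"
    unfolding ef' by (simp_all add: SD algebra_simps flip: scaleR_add_left)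
  have half: "norm S / 2 = h - g" "norm D / 2 = h + g"
    unfolding h_def g_def by - argo+
  have diff: "h *\<^sub>R (e + f) - a = g *\<^sub>R (e - f)" "h *\<^sub>R (e - f) - b = g *\<^sub>R (e + f)"
    unfolding ab half by (simp_all add: algebra_simps)
  have norms: "(norm (g *\<^sub>R (e - f)))\<^sup>2 = 2 * g\<^sup>2" "(norm (g *\<^sub>R (e + f)))\<^sup>2 = 2 * g\<^sup>2"
    using unit unfolding power2_norm_eq_inner
    by (simp_all add: inner_simps inner_commute power2_eq_square)
  have g2: "2 * g\<^sup>2 = (norm (a - b) - norm (a + b))\<^sup>2 / 8"
    by (simp add: g_def SD power_divide)
  show ?thesis
  proof (rule that)
    show "(h *\<^sub>R (e + f)) \<bullet> (h *\<^sub>R (e - f)) = 0"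
      using unit by (simp add: inner_simps inner_commute)
  qed (simp_all only: diff norms g2)
qed

text \<open>Both \<open>a\<close> and \<open>b\<close> are 1 or -1 and \<open>s\<close> is the sign
  of their product; a shift shorter than 1 cannot change the sign of either factor.\<close>

lemma one_dim_sign_margin:
  fixes a b x y :: real
  assumes "a * a = 1" "b * b = 1" "s * (a * b) = 1" "s * ((a + x) * (b + y)) \<le> 0"
  shows "1 \<le> max (x * x) (y * y)"
proof (rule ccontr)
  assume "\<not> ?thesis"
  then have "x\<^sup>2 < 1" "y\<^sup>2 < 1"
    by (simp_all add: power2_eq_square)
  then have *: "\<bar>x\<bar> < 1" "\<bar>y\<bar> < 1"
    by (simp_all only: abs_square_less_1)
  have "a = 1 \<or> a = -1" "b = 1 \<or> b = -1"
    using assms(1,2) by (simp_all add: square_eq_1_iff)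
  then have "0 < a * (a + x)" "0 < b * (b + y)"
    using * by auto
  then have "0 < (a * (a + x)) * (b * (b + y))"
    by simp
  moreover have "s = a * b"
    using assms(1-3) by (metis mult.assoc mult.commute mult.right_neutral)
  ultimately show False
    using assms(4) by (simp add: mult_ac)
qed

section \<open>The sign margin of a scalar covariance\<close>

text \<open>For scalar \<open>W\<close> the quadratic forms are squared norms divided by
  \<open>w\<close>. A bound uniform over all pairs, attained at one point of one pair, settles the
  infimum and the minimum together.\<close>

lemma sign_margin_scaled_identity:
  fixes q :: "nat \<Rightarrow> real^'r"
  assumes "w > 0"
    and lower: "\<And>k l x y. k \<in> {1..K} \<Longrightarrow> l \<in> {1..K} \<Longrightarrow>
      pair_sign k l * ((q k + x) \<bullet> (q l + y)) \<le> 0 \<Longrightarrow> c \<le> max (x \<bullet> x) (y \<bullet> y)"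
    and kl: "1 \<le> k0" "k0 \<le> l0" "l0 \<le> K"
    and att: "pair_sign k0 l0 * ((q k0 + x0) \<bullet> (q l0 + y0)) \<le> 0" "max (x0 \<bullet> x0) (y0 \<bullet> y0) = c"
  shows "sign_margin K q (w *\<^sub>R mat 1) = c / w"
proof -
  let ?A = "\<lambda>k l. {(x, y). pair_sign k l * ((q k + x) \<bullet> (q l + y)) \<le> 0}"
  let ?f = "\<lambda>(x, y). max (x \<bullet> (matrix_inv (w *\<^sub>R mat 1) *v x)) (y \<bullet> (matrix_inv (w *\<^sub>R mat 1) *v y))
    :: real"
  let ?P = "{(k, l). 1 \<le> k \<and> k \<le> l \<and> l \<le> K}"
  have f: "?f (x, y) = max (x \<bullet> x) (y \<bullet> y) / w" for x y :: "real^'r"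
    using \<open>w > 0\<close>
    by (simp add: matrix_inv_scaleR_mat_1 scaleR_matrix_vector_assoc[symmetric] max_def divide_le_cancel)
  have ge: "c / w \<le> ?f z" if "k \<in> {1..K}" "l \<in> {1..K}" "z \<in> ?A k l" for k l z
    using that lower[of k l "fst z" "snd z"] \<open>w > 0\<close> f[of "fst z" "snd z"]
    by (auto simp: divide_right_mono split: prod.splits)
  have INF_ge: "c / w \<le> (INF z\<in>?A k l. ?f z)" if "k \<in> {1..K}" "l \<in> {1..K}" for k l
  proof (rule cINF_greatest)
    \<comment> \<open>Moving both vectors to the origin is always admissible, so the infimum is over
      a nonempty set.\<close>
    have "(- q k, - q l) \<in> ?A k l"
      by simp
    then show "?A k l \<noteq> {}"
      by blast
  qed (use ge that in blast)
  have kl': "k0 \<in> {1..K}" "l0 \<in> {1..K}"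
    using kl by auto
  have "(INF z\<in>?A k0 l0. ?f z) \<le> ?f (x0, y0)"
  proof (rule cINF_lower)
    show "bdd_below (?f ` ?A k0 l0)"
      using ge[OF kl'] by (intro bdd_belowI2)
  qed (use att in simp)
  then have att_eq: "(INF z\<in>?A k0 l0. ?f z) = c / w"
    using INF_ge[OF kl'] f att(2) by (intro antisym) simp_all
  have "finite ?P"
    by (rule finite_subset[of _ "{1..K} \<times> {1..K}"]) auto
  show ?thesis
    unfolding sign_margin_def
  proof (rule Min_eqI)
    show "finite ((\<lambda>(k, l). INF z\<in>?A k l. ?f z) ` ?P)"
      using \<open>finite ?P\<close> by simp
    show "c / w \<in> (\<lambda>(k, l). INF z\<in>?A k l. ?f z) ` ?P"
      using kl att_eq by (intro image_eqI[of _ _ "(k0, l0)"]) auto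
    show "c / w \<le> y" if "y \<in> (\<lambda>(k, l). INF z\<in>?A k l. ?f z) ` ?P" for y
      using that
    proof (rule imageE)
      fix kl
      assume y: "y = (\<lambda>(k, l). INF z\<in>?A k l. ?f z) kl" and "kl \<in> ?P"
      then have "fst kl \<in> {1..K}" "snd kl \<in> {1..K}"
        by auto
      from INF_ge[OF this] show "c / w \<le> y"
        unfolding y case_prod_unfold .
    qed
  qed
qed

section \<open>The constant \<open>C_const\<close> and the margin of the simplex\<close>

text \<open>The radicands are the squared lengths of the difference and the sum of two distinct
  simplex vertices.\<close>

lemma sqrt_diff_square_eq:
  assumes "K \<ge> 2"
  shows "(sqrt (2 * real K) - sqrt (2 * real K - 4))\<^sup>2 / 8
    = (real K - 1 - sqrt (real K * (real K - 2))) / 2"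
proof -
  have "sqrt (2 * real K) * sqrt (2 * real K - 4) = sqrt (4 * (real K * (real K - 2)))"
    by (simp add: algebra_simps flip: real_sqrt_mult)
  also have "\<dots> = 2 * sqrt (real K * (real K - 2))"
    by (simp add: real_sqrt_mult)
  finally show ?thesis
    using assms by (simp add: power2_diff)
qed

text \<open>Since (K-1)^2 - K(K-2) = 1, the conjugates \<open>K - 1 - R\<close> and
  \<open>K - 1 + R\<close> are reciprocal.\<close>

lemma two_div_C_const:
  assumes "K \<ge> 3"
  shows "2 / C_const K = (real K - 1 - sqrt (real K * (real K - 2))) / 2"
proof -
  define R where "R = sqrt (real K * (real K - 2))"
  have "R * R = real K * (real K - 2)" "R \<ge> 0"
    using assms by (simp_all add: R_def)
  then have "(real K - 1 - R) * (real K - 1 + R) = 1"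
    by (simp add: algebra_simps)
  moreover have "real K - 1 + R > 0"
    using assms \<open>R \<ge> 0\<close> by simp
  ultimately have "real K - 1 - R = 1 / (real K - 1 + R)"
    by (simp add: field_simps)
  then show ?thesis
    using assms \<open>real K - 1 + R > 0\<close> unfolding C_const_def R_def[symmetric]
    by (simp add: field_simps)
qed

lemma C_const_pos: "K \<ge> 2 \<Longrightarrow> C_const K > 0"
  unfolding C_const_def by (auto intro!: add_pos_nonneg)

lemma sign_margin_simplex:
  fixes q :: "nat \<Rightarrow> real^'r"
  assumes K: "K \<ge> 2" and r: "CARD('r) = K - 1" and "w > 0"
    and simplex: "\<And>k l. k \<in> {1..K} \<Longrightarrow> l \<in> {1..K} \<Longrightarrow>
      q k \<bullet> q l = real K * (if k = l then 1 else 0) - 1"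
  shows "sign_margin K q (w *\<^sub>R mat 1) = 2 / C_const K / w"
proof (cases "K = 2")
  \<comment> \<open>On the line two vectors are orthogonal only if one of them vanishes, so the bound of
    \<open>acute_pair_distance\<close> is not sharp for \<open>k = l\<close> and falls short of \<open>2 / C_const 2\<close>.\<close>
  case True
  then have "CARD('r) = 1"
    using r by simp
  then obtain i :: 'r where "UNIV = {i}"
    using card_1_singletonE by blast
  then have inner: "v \<bullet> v' = v $ i * v' $ i" for v v' :: "real^'r"
    unfolding inner_vec_def \<open>UNIV = {i}\<close> by simp
  have sq: "q k $ i * q k $ i = 1" if "k \<in> {1..K}" for k
    using simplex[OF that that] True by (simp add: inner)
  show ?thesis
  \<comment> \<open>Moving both points to the origin costs 1, which is
    \<open>2 / C_const 2\<close>.\<close>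
  proof (rule sign_margin_scaled_identity[of _ _ _ _ 1 2 "- q 1" "- q 2"])
    fix k l and x y :: "real^'r"
    assume *: "k \<in> {1..K}" "l \<in> {1..K}" "pair_sign k l * ((q k + x) \<bullet> (q l + y)) \<le> 0"
    have "pair_sign k l * (q k $ i * q l $ i) = 1"
      using simplex[OF *(1,2)] True by (simp add: inner pair_sign_def split: if_splits)
    then have "1 \<le> max (x \<bullet> x) (y \<bullet> y)"
      using one_dim_sign_margin[OF sq[OF *(1)] sq[OF *(2)]] *(3) by (simp add: inner)
    then show "2 / C_const K \<le> max (x \<bullet> x) (y \<bullet> y)"
      using True by (simp add: C_const_def)
  qed (use True \<open>w > 0\<close> in \<open>auto simp: C_const_def simplex\<close>)
next
  case False
  then have K3: "K \<ge> 3"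
    using K by simp
  define c where "c = (sqrt (2 * real K) - sqrt (2 * real K - 4))\<^sup>2 / 8"
  have c: "c = 2 / C_const K" and c_le: "c \<le> (real K - 1) / 2"
    using K3 by (simp_all add: c_def sqrt_diff_square_eq two_div_C_const)
  have norms: "norm (q k - q l) = sqrt (2 * real K)" "norm (q k + q l) = sqrt (2 * real K - 4)"
    if "k \<in> {1..K}" "l \<in> {1..K}" "k \<noteq> l" for k l
    using that by (simp_all add: norm_eq_sqrt_inner inner_simps simplex algebra_simps)
  have one_two: "1 \<in> {1..K}" "2 \<in> {1..K}"
    using K3 by auto
  have "q 1 \<bullet> q 1 = q 2 \<bullet> q 2"
    using one_two by (simp add: simplex)
  \<comment> \<open>The sum has squared length 2K - 4, nonzero because
    \<open>K \<ge> 3\<close>.\<close>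
  moreover have "norm (q 1 + q 2) \<noteq> 0" "norm (q 1 - q 2) \<noteq> 0"
    using norms[OF one_two] K3 by simp_all
  ultimately obtain u v where uv: "u \<bullet> v = 0" "(norm (u - q 1))\<^sup>2 = c" "(norm (v - q 2))\<^sup>2 = c"
    using acute_pair_distance_attained[of "q 1" "q 2"] norms[OF one_two] by (auto simp: c_def)
  have "sign_margin K q (w *\<^sub>R mat 1) = c / w"
  proof (rule sign_margin_scaled_identity[of _ _ _ _ 1 2 "u - q 1" "v - q 2"])
    fix k l and x y :: "real^'r"
    assume *: "k \<in> {1..K}" "l \<in> {1..K}" "pair_sign k l * ((q k + x) \<bullet> (q l + y)) \<le> 0"
    show "c \<le> max (x \<bullet> x) (y \<bullet> y)"
    proof (cases "k = l")
      case True
      \<comment> \<open>For a repeated index, negating the second vector turns the constraint into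
        the acute one for the antipodal pair \<open>q k\<close>, \<open>- q k\<close>. The cost is
        at least (K-1)/2, hence at least \<open>c\<close>.\<close>
      have "(norm (q k - - q k))\<^sup>2 / 8 \<le> max (x \<bullet> x) (y \<bullet> y)"
        using acute_pair_distance[of "q k" "- q k" "q k + x" "- (q k + y)"] *(3) True
        by (simp add: pair_sign_def power2_norm_eq_inner inner_minus_right
            del: minus_add_distrib add_uminus_conv_diff diff_minus_eq_add)
      also have "(norm (q k - - q k))\<^sup>2 = 4 * (real K - 1)"
        using simplex[OF *(1) *(1)]
        unfolding power2_norm_eq_inner diff_minus_eq_add inner_add_left inner_add_right by simp
      finally show ?thesis
        using c_le by linarith
    next
      case False
      then show ?thesis
        using acute_pair_distance[of "q k" "q l" "q k + x" "q l + y"] * norms[OF *(1,2)]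
        by (simp add: pair_sign_def power2_norm_eq_inner simplex c_def)
    qed
  qed (use uv K3 \<open>w > 0\<close> in \<open>auto simp: power2_norm_eq_inner\<close>)
  then show ?thesis
    by (simp add: c)
qed

section \<open>The critical equation\<close>

text \<open>Completing the square gives the roots \<open>h * (1 + R)\<close> and
  \<open>h * (1 - R)\<close>; the second is not positive because \<open>R \<ge> 1\<close>.\<close>

lemma critical_ratio_iff:
  fixes A g s \<sigma> :: real
  assumes "A > 0" "g \<ge> 0" "s > 0" "\<sigma> > 0"
  shows "s = A * \<sigma>\<^sup>2 / 2 * (1 + sqrt (1 + 4 * g / A)) \<longleftrightarrow> s\<^sup>2 / (\<sigma>\<^sup>2 * s + \<sigma> ^ 4 * g) = A"
proof -
  define h where "h = A * \<sigma>\<^sup>2 / 2"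
  define R where "R = sqrt (1 + 4 * g / A)"
  have "h > 0" "R \<ge> 1"
    using assms by (simp_all add: h_def R_def)
  have "\<sigma>\<^sup>2 * s + \<sigma> ^ 4 * g > 0"
    using assms by (intro add_pos_nonneg) simp_all
  then have "s\<^sup>2 / (\<sigma>\<^sup>2 * s + \<sigma> ^ 4 * g) = A \<longleftrightarrow> s\<^sup>2 = A * (\<sigma>\<^sup>2 * s + \<sigma> ^ 4 * g)"
    by (simp add: divide_eq_eq)
  also have "\<dots> \<longleftrightarrow> (s - h)\<^sup>2 = (h * R)\<^sup>2"
  proof -
    have "(h * R)\<^sup>2 = h\<^sup>2 + h\<^sup>2 * (4 * g / A)"
      using assms by (simp add: R_def power_mult_distrib distrib_left)
    also have "h\<^sup>2 * (4 * g / A) = A * \<sigma> ^ 4 * g"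
      using assms by (simp add: h_def power2_eq_square power4_eq_xxxx)
    finally have "(h * R)\<^sup>2 = h\<^sup>2 + A * \<sigma> ^ 4 * g" .
    then show ?thesis
      by (simp add: power2_diff) (simp add: h_def algebra_simps)
  qed
  also have "\<dots> \<longleftrightarrow> s = h * (1 + R)"
  proof -
    have "h * 1 \<le> h * R"
      using \<open>h > 0\<close> \<open>R \<ge> 1\<close> by (intro mult_left_mono) simp_all
    then show ?thesis
      using \<open>s > 0\<close> unfolding power2_eq_iff by (auto simp: algebra_simps)
  qed
  finally show ?thesis
    by (simp add: h_def R_def)
qed

theorem corollary3p7:
  fixes K :: nat and \<pi> :: "nat \<Rightarrow> real" and m :: "nat \<Rightarrow> real^'r"
    and p :: "nat \<Rightarrow> nat" and U :: "nat \<Rightarrow> nat \<Rightarrow> real^'r"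
    and L \<sigma> :: "nat \<Rightarrow> real" and \<mu> :: "nat \<Rightarrow> nat \<Rightarrow> real"
    and M :: "nat \<Rightarrow> 'w measure" and Z :: "nat \<Rightarrow> nat \<Rightarrow> 'w \<Rightarrow> nat"
    and \<xi> x :: "nat \<Rightarrow> nat \<Rightarrow> 'w \<Rightarrow> nat \<Rightarrow> real"
  assumes K: "K \<ge> 2" and r: "CARD('r) = K - 1"
    and weights_pos: "\<And>k. k \<in> {1..K} \<Longrightarrow> \<pi> k > 0"
    and weights_sum: "(\<Sum>k=1..K. \<pi> k) = 1"
    and centered: "(\<Sum>k=1..K. \<pi> k *\<^sub>R m k) = 0"
    and D0_pos_def: "pos_def (D0 K \<pi> m)"
    and D0_normalized: "lambda_min (D0 K \<pi> m) = 1"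
    and model: "\<And>n. n \<ge> K \<Longrightarrow>
      gaussian_mixture_sample (M n) K \<pi> m n (p n) (U n) (L n) (\<sigma> n) (\<mu> n) (Z n) (\<xi> n) (x n)"
    and balanced: "\<And>k. k \<in> {1..K} \<Longrightarrow> \<pi> k = 1 / real K"
    and simplex: "\<And>k l. k \<in> {1..K} \<Longrightarrow> l \<in> {1..K} \<Longrightarrow>
      m k \<bullet> m l = real K * (if k = l then 1 else 0) - 1"
  shows "D0 K \<pi> m = mat 1 \<and>
    (\<forall>n\<ge>K.
       (\<exists>!t. is_crit K \<pi> m (p n) n t) \<and>
       L_crit K \<pi> m (p n) (\<sigma> n) n
         = C_const K * (\<sigma> n)\<^sup>2 * ln (real n) / 2
             * (1 + sqrt (1 + 4 * real (p n) / (C_const K * real n * ln (real n)))) \<and>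
       (L_crit K \<pi> m (p n) (\<sigma> n) n)\<^sup>2
         / ((\<sigma> n)\<^sup>2 * L_crit K \<pi> m (p n) (\<sigma> n) n + (\<sigma> n) ^ 4 * real (p n) / real n)
         = C_const K * ln (real n) \<and>
       (\<forall>s>0.
          s = C_const K * (\<sigma> n)\<^sup>2 * ln (real n) / 2
                * (1 + sqrt (1 + 4 * real (p n) / (C_const K * real n * ln (real n))))
          \<longleftrightarrow> s\<^sup>2 / ((\<sigma> n)\<^sup>2 * s + (\<sigma> n) ^ 4 * real (p n) / real n)
                = C_const K * ln (real n)))"
proof (intro conjI allI impI)
  have D: "D0 K \<pi> m = mat 1"
    using D0_simplex[OF _ centered D0_pos_def balanced simplex] K by simp
  then show "D0 K \<pi> m = mat 1" .
  have q: "whitened K \<pi> m = m"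
    by (simp add: fun_eq_iff whitened_def D mat_sqrt_mat_1 matrix_inv_mat_1)
  fix n
  assume n: "n \<ge> K"
  define A g where "A = C_const K * ln (real n)" and "g = real (p n) / real n"
  \<comment> \<open>The positive root as a function of the noise level: \<open>F 1\<close> will be
    the critical \<open>t\<close>, and \<open>F (\<sigma> n)\<close>, which is \<open>F 1\<close>
    times the noise variance, the critical signal strength.\<close>
  define F where "F = (\<lambda>s. A * s\<^sup>2 / 2 * (1 + sqrt (1 + 4 * g / A)))"
  interpret gaussian_mixture_sample "M n" K \<pi> m n "p n" "U n" "L n" "\<sigma> n" "\<mu> n" "Z n" "\<xi> n" "x n"
    by (rule model[OF n])
  have "A > 0" "g \<ge> 0"
    using C_const_pos[OF K] n K by (simp_all add: A_def g_def)
  have F_pos: "F s > 0" if "s > 0" for s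
    using \<open>A > 0\<close> \<open>g \<ge> 0\<close> that unfolding F_def
    by (intro mult_pos_pos add_pos_nonneg) simp_all
  have F_eq: "C_const K * (\<sigma> n)\<^sup>2 * ln (real n) / 2
      * (1 + sqrt (1 + 4 * real (p n) / (C_const K * real n * ln (real n)))) = F (\<sigma> n)"
    by (simp add: F_def A_def g_def mult_ac)
  have crit: "is_crit K \<pi> m (p n) n t \<longleftrightarrow> t = F 1" for t
  proof (cases "t > 0")
    case True
    define w where "w = 1 / t + g / t\<^sup>2"
    have "w > 0"
      using True \<open>g \<ge> 0\<close> by (simp add: w_def add_pos_nonneg)
    have "Omega (D0 K \<pi> m) g t = w *\<^sub>R mat 1"
      by (simp add: Omega_def D matrix_inv_mat_1 w_def scaleR_add_left)
    then have "is_crit K \<pi> m (p n) n t \<longleftrightarrow> 2 / C_const K / w = 2 * ln (real n)"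
      using sign_margin_simplex[OF K r \<open>w > 0\<close> simplex] True
      by (simp add: is_crit_def q flip: g_def)
    also have "\<dots> \<longleftrightarrow> 1 / w = A"
      using C_const_pos[OF K] \<open>w > 0\<close> by (auto simp: A_def field_simps)
    \<comment> \<open>The powers of 1 put the equation in the form of
      \<open>critical_ratio_iff\<close> at unit noise level.\<close>
    also have "1 / w = t\<^sup>2 / (1\<^sup>2 * t + 1 ^ 4 * g)"
      using True \<open>g \<ge> 0\<close> by (simp add: w_def power2_eq_square field_simps)
    also have "\<dots> = A \<longleftrightarrow> t = F 1"
      using critical_ratio_iff[OF \<open>A > 0\<close> \<open>g \<ge> 0\<close> True zero_less_one] by (simp add: F_def)
    finally show ?thesis .
  next
    case False
    then show ?thesis
      using F_pos[of 1] by (auto simp: is_crit_def)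
  qed
  then show "\<exists>!t. is_crit K \<pi> m (p n) n t"
    by simp
  have "t_crit K \<pi> m (p n) n = F 1"
    by (simp add: t_crit_def crit)
  then have "L_crit K \<pi> m (p n) (\<sigma> n) n = F (\<sigma> n)"
    by (simp add: L_crit_def F_def)
  then show L: "L_crit K \<pi> m (p n) (\<sigma> n) n = C_const K * (\<sigma> n)\<^sup>2 * ln (real n) / 2
      * (1 + sqrt (1 + 4 * real (p n) / (C_const K * real n * ln (real n))))"
    by (simp only: F_eq)
  show ratio: "s = C_const K * (\<sigma> n)\<^sup>2 * ln (real n) / 2
        * (1 + sqrt (1 + 4 * real (p n) / (C_const K * real n * ln (real n))))
      \<longleftrightarrow> s\<^sup>2 / ((\<sigma> n)\<^sup>2 * s + (\<sigma> n) ^ 4 * real (p n) / real n) = C_const K * ln (real n)"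
    if "s > 0" for s
    using critical_ratio_iff[OF \<open>A > 0\<close> \<open>g \<ge> 0\<close> that sigma_pos]
    unfolding F_eq by (simp add: F_def A_def g_def)
  show "(L_crit K \<pi> m (p n) (\<sigma> n) n)\<^sup>2
      / ((\<sigma> n)\<^sup>2 * L_crit K \<pi> m (p n) (\<sigma> n) n + (\<sigma> n) ^ 4 * real (p n) / real n)
      = C_const K * ln (real n)"
    using ratio[of "L_crit K \<pi> m (p n) (\<sigma> n) n"] L F_pos[OF sigma_pos] unfolding F_eq by simp
qed

end
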